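(* Let $X\subseteq\mathbb{C}$ and $\varphi:\mathbb{N}\times X\to X$, written $\varphi_n(x)=\varphi(n,x)$, satisfy $\varphi_m(\varphi_n(x))=\varphi_{mn}(x)$ for all $m,n\in\mathbb{N}$, $x\in X$, and $\varphi_1(x)=x$ for all $x\in X$. Let $f:\mathbb{N}\to\mathbb{C}$ with $f(1)\ne0$ and let $\alpha,\beta:X\to\mathbb{C}$ be arbitrary functions. Assume that $\sum_{n=1}^\infty\sum_{m=1}^\infty\frac{f(n)f^{-1\circ}(m)}{\xi(n)\xi(m)}\beta(\varphi_{mn}(x))$ is absolutely convergent. If $$\alpha(x)=\sum_{n=1}^\infty\frac{f(n)}{\xi(n)}\beta(\varphi_n(x))\quad\text{for all }x\in X,$$ then $$\beta(x)=\sum_{n=1}^\infty\frac{f^{-1\circ}(n)}{\xi(n)}\alpha(\varphi_n(x))\quad\text{for all }x\in X.$$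
   Context: Writing $n=\prod_p p^{\nu_p(n)}$, $\xi(n)=\prod_p\nu_p(n)!$. The binomial convolution is $(f\circ g)(n)=\sum_{d\mid n}\left(\prod_p\binom{\nu_p(n)}{\nu_p(d)}\right)f(d)g(n/d)$, with identity $\delta$ ($\delta(1)=1$, $\delta(n)=0$ for $n>1$); $f^{-1\circ}$ is the inverse of $f$ under $\circ$, which exists since $f(1)\ne0$. *)

theory Defs
  imports "HOL-Analysis.Analysis" "HOL-Computational_Algebra.Primes"
begin

text \<open>
  Arithmetic functions on the positive integers are represented as functions on \<^typ>\<open>nat\<close> whose
  value at \<open>0\<close> is irrelevant. Products over all primes are restricted to the prime factors
  of \<open>n\<close>; for \<open>d dvd n\<close> every other factor is \<open>fact 0 = 1\<close> or \<open>0 choose 0 = 1\<close>.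
\<close>

definition xi :: "nat \<Rightarrow> nat" where
  "xi n = (\<Prod>p\<in>prime_factors n. fact (multiplicity p n))"

definition prime_binomial :: "nat \<Rightarrow> nat \<Rightarrow> nat" where
  "prime_binomial n d = (\<Prod>p\<in>prime_factors n. multiplicity p n choose multiplicity p d)"

definition binomial_conv :: "(nat \<Rightarrow> complex) \<Rightarrow> (nat \<Rightarrow> complex) \<Rightarrow> nat \<Rightarrow> complex" where
  "binomial_conv f g n = (\<Sum>d | d dvd n. of_nat (prime_binomial n d) * f d * g (n div d))"

definition delta :: "nat \<Rightarrow> complex" where
  "delta n = (if n = 1 then 1 else 0)"

text \<open>The condition \<open>g 0 = 0\<close> only fixes the irrelevant value, so that the inverse is unique.\<close>

definition is_binomial_inverse :: "(nat \<Rightarrow> complex) \<Rightarrow> (nat \<Rightarrow> complex) \<Rightarrow> bool" where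
  "is_binomial_inverse f g \<longleftrightarrow> g 0 = 0 \<and>
     (\<forall>n\<ge>1. binomial_conv f g n = delta n \<and> binomial_conv g f n = delta n)"

definition binomial_inverse :: "(nat \<Rightarrow> complex) \<Rightarrow> nat \<Rightarrow> complex" where
  "binomial_inverse f = (THE g. is_binomial_inverse f g)"

lemma prime_binomial_sym:
  assumes "n \<ge> 1" "d dvd n"
  shows "prime_binomial n (n div d) = prime_binomial n d"
  unfolding prime_binomial_def
proof (rule prod.cong[OF refl])
  fix p assume p: "p \<in> prime_factors n"
  from assms obtain e where e: "n = d * e" by (elim dvdE)
  with assms have nz: "d \<noteq> 0" "e \<noteq> 0" by auto
  from p have "prime p" by auto
  then have m: "multiplicity p n = multiplicity p d + multiplicity p e"
    using nz e by (simp add: prime_elem_multiplicity_mult_distrib)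
  have "n div d = e" using e nz by simp
  then show "multiplicity p n choose multiplicity p (n div d) =
      multiplicity p n choose multiplicity p d"
    using m by (metis add_diff_cancel_left' binomial_symmetric le_add1)
qed

lemma binomial_conv_commute:
  assumes "n \<ge> 1"
  shows "binomial_conv f g n = binomial_conv g f n"
  unfolding binomial_conv_def
proof (rule sum.reindex_bij_witness[where i = "\<lambda>d. n div d" and j = "\<lambda>d. n div d"], goal_cases)
  case (5 d)
  then have "n div (n div d) = d" using assms by (auto elim!: dvdE)
  with 5 show ?case using prime_binomial_sym[OF assms, of d] by (simp add: mult_ac)
qed (use assms in \<open>auto elim!: dvdE\<close>)

lemma binomial_conv_rec:
  assumes "n \<ge> 1"
  shows "binomial_conv g f n =
    g n * f 1 + (\<Sum>d | d dvd n \<and> d < n. of_nat (prime_binomial n d) * g d * f (n div d))"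
proof -
  have "{d. d dvd n} = insert n {d. d dvd n \<and> d < n}"
    using assms by (auto dest: dvd_imp_le)
  moreover have "prime_binomial n n = 1" by (simp add: prime_binomial_def)
  ultimately show ?thesis using assms by (simp add: binomial_conv_def)
qed

lemma ex1_binomial_inverse:
  assumes f1: "f 1 \<noteq> 0"
  shows "\<exists>!g. is_binomial_inverse f g"
proof (rule ex_ex1I)
  define F where "F = (\<lambda>h n. if n = 0 then 0 else
    (delta n - (\<Sum>d | d dvd n \<and> d < n. of_nat (prime_binomial n d) * h d * f (n div d))) / f 1)"
  define g where "g = wfrec less_than F"
  have g: "g n = F g n" for n
  proof -
    have "g n = F (cut g less_than n) n"
      by (rule def_wfrec) (simp_all add: g_def)
    also have "\<dots> = F g n"
    proof -
      have "(\<Sum>d | d dvd n \<and> d < n.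
            of_nat (prime_binomial n d) * cut g less_than n d * f (n div d)) =
          (\<Sum>d | d dvd n \<and> d < n. of_nat (prime_binomial n d) * g d * f (n div d))"
        by (rule sum.cong) (auto simp: cut_apply)
      then show ?thesis by (simp add: F_def)
    qed
    finally show ?thesis .
  qed
  have "binomial_conv g f n = delta n" if "n \<ge> 1" for n
    using that f1 by (simp only: binomial_conv_rec, subst g) (simp add: F_def)
  moreover have "g 0 = 0" by (subst g) (simp add: F_def)
  ultimately have "is_binomial_inverse f g"
    by (simp add: is_binomial_inverse_def binomial_conv_commute[of _ f g])
  then show "\<exists>g. is_binomial_inverse f g" by (rule exI[of _ g])
next
  fix g h assume gh: "is_binomial_inverse f g" "is_binomial_inverse f h"
  show "g = h"
  proof
    fix n show "g n = h n"
    proof (induction n rule: less_induct)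
      case (less n)
      show ?case
      proof (cases "n = 0")
        case True
        then show ?thesis using gh by (simp add: is_binomial_inverse_def)
      next
        case False
        then have n: "n \<ge> 1" by simp
        have "binomial_conv g f n = binomial_conv h f n"
          using gh n by (simp add: is_binomial_inverse_def)
        moreover have "(\<Sum>d | d dvd n \<and> d < n. of_nat (prime_binomial n d) * g d * f (n div d)) =
            (\<Sum>d | d dvd n \<and> d < n. of_nat (prime_binomial n d) * h d * f (n div d))"
          by (rule sum.cong) (auto simp: less)
        ultimately show ?thesis using f1 by (simp add: binomial_conv_rec[OF n])
      qed
    qed
  qed
qed

lemma binomial_inverse:
  assumes "f 1 \<noteq> 0"
  shows "is_binomial_inverse f (binomial_inverse f)"
  unfolding binomial_inverse_def by (rule theI'[OF ex1_binomial_inverse[of f, OF assms]])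

end

theory Submission
  imports Defs
begin

text \<open>
  The identity \<open>prime_binomial n d / \<xi>(n) = 1 / (\<xi>(d) \<xi>(n/d))\<close> turns the binomial convolution into
  the Dirichlet convolution of \<open>f/\<xi>\<close> and \<open>g/\<xi>\<close>. By absolute convergence the double series
  \<open>\<Sum> f(n) g(m) \<beta>(\<phi>\<^sub>m\<^sub>n(x)) / (\<xi>(n) \<xi>(m))\<close> with \<open>g = f\<^sup>-\<^sup>1\<close> may be summed in two ways: summing over
  \<open>n\<close> first gives \<open>\<Sum> g(m) \<alpha>(\<phi>\<^sub>m(x)) / \<xi>(m)\<close>, and grouping by the product \<open>k = m n\<close> gives
  \<open>\<Sum> \<delta>(k) \<beta>(\<phi>\<^sub>k(x)) / \<xi>(k) = \<beta>(x)\<close>.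
\<close>

lemma xi_nonzero: "xi n \<noteq> 0"
  by (simp add: xi_def)

text \<open>A prime factor of \<open>n\<close> not dividing \<open>d\<close> has exponent 0 in
  \<open>d\<close> and contributes \<open>fact 0 = 1\<close>. This puts all three products in
  \<open>prime_binomial_mult_xi\<close> over the same index set.\<close>

lemma xi_eq_prod_superset:
  assumes "n \<ge> 1" "d dvd n"
  shows "xi d = (\<Prod>p\<in>prime_factors n. fact (multiplicity p d))"
  unfolding xi_def
proof (rule prod.mono_neutral_left)
  show "prime_factors d \<subseteq> prime_factors n"
    using assms by (intro dvd_prime_factors) auto
  have "d \<noteq> 0" using assms by auto
  then have "multiplicity p d = 0" if "p \<in> prime_factors n - prime_factors d" for p
    using that by (intro not_dvd_imp_multiplicity_0) (auto simp: prime_factors_dvd)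
  then show "\<forall>p\<in>prime_factors n - prime_factors d. fact (multiplicity p d) = (1::nat)"
    by simp
qed simp

text \<open>Exponents add in \<open>n = d * e\<close>, so each prime contributes (a+b choose a) * a!
  * b! = (a+b)!.\<close>

lemma prime_binomial_mult_xi:
  assumes "n \<ge> 1" "d dvd n"
  shows "prime_binomial n d * (xi d * xi (n div d)) = xi n"
proof -
  obtain e where e: "n = d * e" using assms(2) by (elim dvdE)
  with assms have nz: "d \<noteq> 0" "e \<noteq> 0" by auto
  have "n div d = e" "e dvd n" using e nz by simp_all
  have "prime_binomial n d * (xi d * xi e) =
      (\<Prod>p\<in>prime_factors n. (multiplicity p n choose multiplicity p d) *
        (fact (multiplicity p d) * fact (multiplicity p e)))"
    unfolding prime_binomial_def xi_eq_prod_superset[OF assms]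
      xi_eq_prod_superset[OF assms(1) \<open>e dvd n\<close>] by (simp add: prod.distrib)
  also have "\<dots> = xi n"
    unfolding xi_def
  proof (rule prod.cong[OF refl])
    fix p assume "p \<in> prime_factors n"
    then have "prime p" by auto
    then have m: "multiplicity p n = multiplicity p d + multiplicity p e"
      using nz e by (simp add: prime_elem_multiplicity_mult_distrib)
    have "fact (multiplicity p d) * fact (multiplicity p n - multiplicity p d) *
        (multiplicity p n choose multiplicity p d) = (fact (multiplicity p n) :: nat)"
      by (rule binomial_fact_lemma) (simp add: m)
    then show "(multiplicity p n choose multiplicity p d) *
        (fact (multiplicity p d) * fact (multiplicity p e)) = fact (multiplicity p n)"
      by (simp add: m mult_ac)
  qed
  finally show ?thesis using \<open>n div d = e\<close> by simp
qed

lemma binomial_conv_over_xi: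
  assumes "n \<ge> 1"
  shows "binomial_conv f g n / of_nat (xi n) =
    (\<Sum>d | d dvd n. f d * g (n div d) / (of_nat (xi d) * of_nat (xi (n div d))))"
  unfolding binomial_conv_def sum_divide_distrib
proof (rule sum.cong[OF refl])
  fix d assume "d \<in> {d. d dvd n}"
  then have "of_nat (xi n) =
      (of_nat (prime_binomial n d) * (of_nat (xi d) * of_nat (xi (n div d))) :: complex)"
    using prime_binomial_mult_xi[OF assms, of d] by (metis mem_Collect_eq of_nat_mult)
  \<comment> \<open>As a factor of the nonzero \<open>xi n\<close>, the binomial weight can be
    cancelled from the quotient.\<close>
  moreover from this have "of_nat (prime_binomial n d) \<noteq> (0 :: complex)"
    using xi_nonzero[of n] by (metis mult_zero_left of_nat_eq_0_iff)
  ultimately show "of_nat (prime_binomial n d) * f d * g (n div d) / of_nat (xi n) =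
      f d * g (n div d) / (of_nat (xi d) * of_nat (xi (n div d)))"
    by (simp add: mult.assoc)
qed

text \<open>The map (n, m) to (n * m, n) is a bijection from pairs of positive integers onto pairs
  (k, d) with \<open>d dvd k\<close>. The fibre over each k is finite, so its inner sum is an
  ordinary one.\<close>

lemma has_sum_divisors:
  fixes F :: "nat \<times> nat \<Rightarrow> 'a :: {topological_comm_monoid_add, t3_space}"
  assumes "(F has_sum S) ({1..} \<times> {1..})"
  shows "((\<lambda>k. \<Sum>d | d dvd k. F (d, k div d)) has_sum S) {1..}"
proof (rule has_sum_SigmaD)
  have "(F has_sum S) ({1..} \<times> {1..}) \<longleftrightarrow>
      ((\<lambda>(k, d). F (d, k div d)) has_sum S) (Sigma {1..} (\<lambda>k. {d. d dvd k}))"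
    by (rule has_sum_reindex_bij_witness[where j = "\<lambda>(n, m). (n * m, n)"
          and i = "\<lambda>(k, d). (d, k div d)"])
      (auto elim!: dvdE)
  with assms show "((\<lambda>(k, d). F (d, k div d)) has_sum S) (Sigma {1..} (\<lambda>k. {d. d dvd k}))"
    by simp
  fix k :: nat assume "k \<in> {1..}"
  then show "((\<lambda>d. case (k, d) of (k, d) \<Rightarrow> F (d, k div d)) has_sum (\<Sum>d | d dvd k. F (d, k div d))) {d. d dvd k}"
    by (intro has_sum_finiteI) auto
qed

text \<open>Links unordered sums over the positive integers with \<open>sums\<close>, whose index
  starts at 0.\<close>

lemma has_sum_Suc_iff:
  "((\<lambda>k. F (Suc k)) has_sum S) UNIV \<longleftrightarrow> (F has_sum S) {1..}"
  by (rule has_sum_reindex_bij_witness[where i = "\<lambda>n. n - 1" and j = Suc]) auto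

theorem theorem7p2:
  fixes X :: "complex set"
    and \<phi> :: "nat \<Rightarrow> complex \<Rightarrow> complex"
    and f :: "nat \<Rightarrow> complex"
    and \<alpha> \<beta> :: "complex \<Rightarrow> complex"
  assumes "\<And>n x. n \<ge> 1 \<Longrightarrow> x \<in> X \<Longrightarrow> \<phi> n x \<in> X"
    and "\<And>m n x. m \<ge> 1 \<Longrightarrow> n \<ge> 1 \<Longrightarrow> x \<in> X \<Longrightarrow> \<phi> m (\<phi> n x) = \<phi> (m * n) x"
    and "\<And>x. x \<in> X \<Longrightarrow> \<phi> 1 x = x"
    and "f 1 \<noteq> 0"
    and "\<And>x. x \<in> X \<Longrightarrow>
      (\<lambda>(n, m). norm (f n * binomial_inverse f m / (of_nat (xi n) * of_nat (xi m)) * \<beta> (\<phi> (m * n) x)))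
        summable_on ({1..} \<times> {1..})"
    and "\<And>x. x \<in> X \<Longrightarrow>
      (\<lambda>k. f (Suc k) / of_nat (xi (Suc k)) * \<beta> (\<phi> (Suc k) x)) sums \<alpha> x"
  shows "\<forall>x\<in>X. (\<lambda>k. binomial_inverse f (Suc k) / of_nat (xi (Suc k)) * \<alpha> (\<phi> (Suc k) x)) sums \<beta> x"
proof
  fix x assume x: "x \<in> X"
  define g where "g = binomial_inverse f"
  define H where
    "H = (\<lambda>(n, m). f n * g m / (of_nat (xi n) * of_nat (xi m)) * \<beta> (\<phi> (m * n) x))"
  have "(\<lambda>p. norm (H p)) summable_on ({1..} \<times> {1..})"
    using assms(5)[OF x] by (simp add: H_def g_def case_prod_unfold)
  then have "H summable_on ({1..} \<times> {1..})"
    by (rule abs_summable_summable)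
  then obtain S where S: "(H has_sum S) ({1..} \<times> {1..})"
    by (auto simp: summable_on_def)

  \<comment> \<open>On the fibre m * n = k the factor \<open>\<beta> (\<phi> k x)\<close> is
    constant and comes out, leaving the convolution of \<open>f\<close> with its inverse.\<close>
  have conv: "(\<Sum>d | d dvd k. H (d, k div d)) = (if k = 1 then \<beta> x else 0)" if "k \<ge> 1" for k
  proof -
    have "(\<Sum>d | d dvd k. H (d, k div d)) = binomial_conv f g k / of_nat (xi k) * \<beta> (\<phi> k x)"
      unfolding binomial_conv_over_xi[OF that] sum_distrib_right
      by (rule sum.cong) (auto simp: H_def)
    also have "binomial_conv f g k = delta k"
      using binomial_inverse[of f, OF assms(4)] that
      by (simp add: is_binomial_inverse_def g_def)
    finally show ?thesis
      using assms(3)[OF x] by (simp add: delta_def xi_def)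
  qed
  have "((\<lambda>k. if k = 1 then \<beta> x else 0) has_sum S) {1::nat..}"
    by (rule has_sum_cong[THEN iffD1, OF _ has_sum_divisors[OF S]]) (simp add: conv)
  moreover have "((\<lambda>k. if k = 1 then \<beta> x else 0) has_sum \<beta> x) {1::nat..}"
    by (rule has_sum_finite_neutralI[where B = "{1}"]) auto
  ultimately have "S = \<beta> x"
    by (rule has_sum_unique)

  have swapped: "((\<lambda>(m, n). H (n, m)) has_sum S) ({1..} \<times> {1..})"
    using S by (subst has_sum_swap) simp
  \<comment> \<open>The hypothesis on \<alpha> gives only ordered convergence, while summing by rows
    needs \<open>has_sum\<close>. Unordered summability is inherited from the double family, and
    uniqueness of limits then identifies the value.\<close>
  have inner: "((\<lambda>n. H (n, m)) has_sum (g m / of_nat (xi m) * \<alpha> (\<phi> m x))) {1..}"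
    if "m \<in> {1..}" for m
  proof -
    have m: "m \<ge> 1" using that by simp
    have "(\<lambda>n. H (n, m)) summable_on {1..}"
      using summable_on_SigmaD1[OF has_sum_imp_summable[OF swapped], of m] that by simp
    then obtain T where T: "((\<lambda>k. H (Suc k, m)) has_sum T) UNIV"
      by (auto simp: summable_on_def has_sum_Suc_iff[of "\<lambda>n. H (n, m)"])
    \<comment> \<open>The series for \<alpha> is taken at the point \<open>\<phi> m x\<close>, which
      lies in \<open>X\<close>; the composition law then turns its terms into those of
      \<open>H\<close>.\<close>
    have "(\<lambda>k. g m / of_nat (xi m) *
        (f (Suc k) / of_nat (xi (Suc k)) * \<beta> (\<phi> (Suc k) (\<phi> m x))))
      sums (g m / of_nat (xi m) * \<alpha> (\<phi> m x))"
      by (intro sums_mult assms(6) assms(1) m x)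
    moreover have "g m / of_nat (xi m) *
        (f (Suc k) / of_nat (xi (Suc k)) * \<beta> (\<phi> (Suc k) (\<phi> m x))) = H (Suc k, m)" for k
      using assms(2)[of "Suc k" m x] m x by (simp add: H_def mult_ac)
    ultimately have "(\<lambda>k. H (Suc k, m)) sums (g m / of_nat (xi m) * \<alpha> (\<phi> m x))"
      by simp
    with has_sum_imp_sums[OF T] have "T = g m / of_nat (xi m) * \<alpha> (\<phi> m x)"
      by (rule sums_unique2)
    with T show ?thesis by (simp add: has_sum_Suc_iff[of "\<lambda>n. H (n, m)"])
  qed
  have "((\<lambda>m. g m / of_nat (xi m) * \<alpha> (\<phi> m x)) has_sum \<beta> x) {1..}"
    using has_sum_SigmaD[OF swapped] inner \<open>S = \<beta> x\<close> by simp
  then have "((\<lambda>k. g (Suc k) / of_nat (xi (Suc k)) * \<alpha> (\<phi> (Suc k) x)) has_sum \<beta> x) UNIV"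
    by (simp only: has_sum_Suc_iff[of "\<lambda>m. g m / of_nat (xi m) * \<alpha> (\<phi> m x)"])
  then show "(\<lambda>k. binomial_inverse f (Suc k) / of_nat (xi (Suc k)) * \<alpha> (\<phi> (Suc k) x)) sums \<beta> x"
    unfolding g_def by (rule has_sum_imp_sums)
qed

end
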